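(* Let $n$ be a positive integer and let $f\in C^{n}([0,\infty))$ be such that both $f(\infty)$ and $f(0)$ exist. Then $$\int_{0}^{\infty}x^{n-1}f^{(n)}(x)\,dx=(-1)^{n-1}\left[f(\infty)-f(0)\right]\Gamma(n),\qquad \Gamma(n)=(n-1)!.$$
   Context: $C^{n}([0,\infty))$ denotes the space of $n$ times continuously differentiable functions on $[0,\infty)$, and $f^{(n)}$ denotes the $n$-th derivative of $f$. The notation $f(\infty)$ means $\lim_{x\to\infty}f(x)$, and its existence means that this limit exists and is finite. The integral over $[0,\infty)$ is an improper integral, $\lim_{R\to\infty}\int_{0}^{R}$.
   Formalization: For n ≥ 2 the formal theorem additionally assumes that the improper integral converges; without this the claim fails, e.g. n = 2, f(x) = sin(x²)/(1+x²), where the integral over [0,R] oscillates like 2cos(R²). *)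

theory Defs
  imports "HOL-Analysis.Analysis"
begin

(* Derivatives are taken relative to S, so on S = {0..} the derivative at 0 is the
   one-sided one, and for x in S the value depends only on the restriction of f to S. *)
primrec nth_deriv_within :: "real set \<Rightarrow> nat \<Rightarrow> (real \<Rightarrow> real) \<Rightarrow> real \<Rightarrow> real" where
  "nth_deriv_within S 0 f = f"
| "nth_deriv_within S (Suc k) f = (\<lambda>x. vector_derivative (nth_deriv_within S k f) (at x within S))"

definition Cn_on :: "nat \<Rightarrow> real set \<Rightarrow> (real \<Rightarrow> real) set" where
  "Cn_on n S = {f. (\<forall>k<n. nth_deriv_within S k f differentiable_on S) \<and>
                   continuous_on S (nth_deriv_within S n f)}"

definition has_improper_integral :: "(real \<Rightarrow> real) \<Rightarrow> real \<Rightarrow> bool" where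
  "has_improper_integral g I \<longleftrightarrow>
     (\<forall>R\<ge>0. g integrable_on {0..R}) \<and> ((\<lambda>R. integral {0..R} g) \<longlongrightarrow> I) at_top"

definition improper_integral_converges :: "(real \<Rightarrow> real) \<Rightarrow> bool" where
  "improper_integral_converges g \<longleftrightarrow> (\<exists>I. has_improper_integral g I)"

(* Convergence of the improper integral of x^(n-1) * f^(n)(x) is automatic for n = 1, but does
   not follow from f being C^n with finite limit at infinity when n >= 2.  For n = 2 and
   f(x) = sin(x^2) / (1 + x^2), the integral over {0..R} is R * f'(R) - f(R) + f(0), which
   behaves like 2 * cos(R^2) and has no limit. For n >= 2 the integral formula is therefore
   read as asserting the value of the integral whenever the integral exists. *)

end

theory Submission
  imports Defs
begin

text \<open>
  The proof evaluates the $n$-th finite difference of $f$ with step $R$ in two ways. Put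
  $g(t) = t^{n-1} f^{(n)}(t)$ and let $R \to \infty$. In
  \[ \sum_{j=0}^{n} (-1)^j {n \choose j} f(jR) \]
  every term except $j = 0$ involves $f$ at a point that tends to infinity, and the signed binomial
  coefficients sum to $0$, so the limit is $f(0) - f(\infty)$.

  On the other hand, expand each $f(jR)$ by Taylor's theorem at $0$ with integral remainder. An
  $n$-th difference kills polynomials of degree less than $n$ (\<open>alternating_binomial_sum_power\<close>).
  This removes the Taylor polynomials; applied to the kernels $(jR - t)^{n-1}$ on $[0, R]$,
  among which only the one for $j = 0$ is absent from the remainders, it makes their combination
  equal to minus the missing kernel, $-(-t)^{n-1}$. What is left is (\<open>finite_difference_identity\<close>)
  \[ \frac{(-1)^n}{(n-1)!} \int_0^R g(t)\,dt + \frac{1}{(n-1)!} \sum_{j=1}^{n} (-1)^j {n \choose j}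
     \int_R^{jR} \left(\frac{jR-t}{t}\right)^{n-1} g(t)\,dt. \]
  The weights $((jR-t)/t)^{n-1}$ are monotone and bounded independently of $R$, so by the second
  mean value theorem the integrals over $[R, jR]$ are controlled by differences of
  $\int_0^x g$ at points beyond $R$; these vanish in the limit because the improper integral
  converges (\<open>tendsto_weighted_tail_integral\<close>). Comparing the two limits gives the value of
  the integral.

  For $n = 1$ the convergence follows from the fundamental theorem of calculus.
\<close>

section \<open>Finite differences of polynomials\<close>

lemma alternating_binomial_sum_Suc:
  fixes u :: "nat \<Rightarrow> 'a::comm_ring_1"
  shows "(\<Sum>j\<le>Suc n. (-1) ^ j * of_nat (Suc n choose j) * u j) =
         (\<Sum>j\<le>n. (-1) ^ j * of_nat (n choose j) * (u j - u (Suc j)))"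
proof -
  have "(\<Sum>j\<le>n. (-1) ^ Suc j * of_nat (Suc n choose Suc j) * u (Suc j)) =
        (\<Sum>j\<le>n. (-1) ^ Suc j * of_nat (n choose Suc j) * u (Suc j))
          - (\<Sum>j\<le>n. (-1) ^ j * of_nat (n choose j) * u (Suc j))"
    unfolding sum_subtractf [symmetric] by (intro sum.cong) (simp_all add: algebra_simps)
  then have "(\<Sum>j\<le>Suc n. (-1) ^ j * of_nat (Suc n choose j) * u j) =
        u 0 + (\<Sum>j\<le>n. (-1) ^ Suc j * of_nat (n choose Suc j) * u (Suc j))
            - (\<Sum>j\<le>n. (-1) ^ j * of_nat (n choose j) * u (Suc j))"
    by (subst sum.atMost_Suc_shift) (simp del: binomial_Suc_Suc power_Suc)
  also have "u 0 + (\<Sum>j\<le>n. (-1) ^ Suc j * of_nat (n choose Suc j) * u (Suc j)) =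
        (\<Sum>j\<le>Suc n. (-1) ^ j * of_nat (n choose j) * u j)"
    by (subst sum.atMost_Suc_shift) simp
  also have "\<dots> = (\<Sum>j\<le>n. (-1) ^ j * of_nat (n choose j) * u j)"
    by (simp add: binomial_eq_0)
  finally show ?thesis
    by (simp add: algebra_simps sum_subtractf)
qed

text \<open>
  One difference lowers the degree of a polynomial by at least one, so more differences than the
  degree leave nothing. The difference of an \<open>i\<close>-th power is a combination of all lower powers, so
  the induction on \<open>n\<close> runs over all exponents at once. The Taylor polynomials use the offset
  \<open>b = 0\<close>, the remainder kernels \<open>b = - t\<close>.
\<close>
lemma alternating_binomial_sum_power:
  fixes a b :: "'a::comm_ring_1"
  assumes "i < n"
  shows "(\<Sum>j\<le>n. (-1) ^ j * of_nat (n choose j) * (b + of_nat j * a) ^ i) = 0"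
  using assms
proof (induction n arbitrary: i)
  case 0
  then show ?case by simp
next
  case (Suc n)
  have diff: "(b + of_nat j * a) ^ i - (b + of_nat (Suc j) * a) ^ i =
      (\<Sum>k<i. - (of_nat (i choose k) * a ^ (i - k)) * (b + of_nat j * a) ^ k)" for j
  proof -
    have "(b + of_nat (Suc j) * a) ^ i = ((b + of_nat j * a) + a) ^ i"
      by (simp add: algebra_simps)
    also have "\<dots> = (\<Sum>k\<le>i. of_nat (i choose k) * (b + of_nat j * a) ^ k * a ^ (i - k))"
      by (rule binomial_ring)
    also have "\<dots> = (\<Sum>k<i. of_nat (i choose k) * (b + of_nat j * a) ^ k * a ^ (i - k))
        + (b + of_nat j * a) ^ i"
      by (simp add: lessThan_Suc_atMost [symmetric])
    finally show ?thesis
      by (simp add: sum_negf mult_ac)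
  qed
  have "(\<Sum>j\<le>Suc n. (-1) ^ j * of_nat (Suc n choose j) * (b + of_nat j * a) ^ i) =
      (\<Sum>j\<le>n. \<Sum>k<i. - (of_nat (i choose k) * a ^ (i - k)) *
          ((-1) ^ j * of_nat (n choose j) * (b + of_nat j * a) ^ k))"
    by (subst alternating_binomial_sum_Suc, subst diff) (simp add: sum_distrib_left mult_ac)
  also have "\<dots> = (\<Sum>k<i. - (of_nat (i choose k) * a ^ (i - k)) *
      (\<Sum>j\<le>n. (-1) ^ j * of_nat (n choose j) * (b + of_nat j * a) ^ k))"
    by (subst sum.swap) (simp add: sum_distrib_left)
  also have "\<dots> = 0"
    using Suc by (intro sum.neutral) auto
  finally show ?case .
qed

section \<open>Weighted tails of a convergent improper integral\<close>

text \<open>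
  The weight decreases from \<open>(q - 1) ^ m\<close> at \<open>R\<close> to \<open>0 ^ m\<close> at \<open>q * R\<close>, values that do not depend
  on \<open>R\<close>. The second mean value theorem therefore writes the integral as a fixed linear
  combination of integrals of \<open>g\<close> over intervals beyond \<open>R\<close>, to which the Cauchy criterion
  applies. (The second end value matters for \<open>m = 0\<close>, where it equals \<open>1\<close>.)
\<close>
lemma tendsto_weighted_tail_integral:
  fixes g :: "real \<Rightarrow> real" and q :: real
  assumes g: "has_improper_integral g I" and q: "q \<ge> 1"
  shows "((\<lambda>R. integral {R..q * R} (\<lambda>t. ((q * R - t) / t) ^ m * g t)) \<longlongrightarrow> 0) at_top"
proof -
  define G where "G = (\<lambda>x. integral {0..x} g)"
  have G: "(G \<longlongrightarrow> I) at_top" and intg: "\<And>x. x \<ge> 0 \<Longrightarrow> g integrable_on {0..x}"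
    using g by (auto simp: has_improper_integral_def G_def)
  have G_diff: "integral {x..y} g = G y - G x" if "0 \<le> x" "x \<le> y" for x y
    using Henstock_Kurzweil_Integration.integral_combine[of 0 x y g] intg[of y] that
    by (simp add: G_def)
  have "\<exists>c. c \<in> {R..q * R} \<and> integral {R..q * R} (\<lambda>t. ((q * R - t) / t) ^ m * g t) =
      (q - 1) ^ m * (G c - G R) + 0 ^ m * (G (q * R) - G c)" if R: "R > 0" for R
  proof -
    have le: "R \<le> q * R"
      using q R by simp
    have int: "g integrable_on {R..q * R}"
      using intg[of "q * R"] R le by (auto elim: integrable_on_subinterval)
    have mono: "- (((q * R - x) / x) ^ m) \<le> - (((q * R - y) / y) ^ m)"
      if "R \<le> x" "x \<le> y" "y \<le> q * R" for x y
      using R that by (auto intro!: power_mono frac_le)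
    obtain c where c: "c \<in> {R..q * R}" and
      eq: "integral {R..q * R} (\<lambda>t. - (((q * R - t) / t) ^ m) * g t) =
           - (((q * R - R) / R) ^ m) * integral {R..c} g
           + - (((q * R - q * R) / (q * R)) ^ m) * integral {c..q * R} g"
      using second_mean_value_theorem[where g = "\<lambda>t. - (((q * R - t) / t) ^ m)", OF int le mono]
      by blast
    have "(q * R - R) / R = q - 1"
      using R by (simp add: field_simps)
    with eq c R have "integral {R..q * R} (\<lambda>t. ((q * R - t) / t) ^ m * g t) =
        (q - 1) ^ m * (G c - G R) + 0 ^ m * (G (q * R) - G c)"
      by (simp add: G_diff)
    with c show ?thesis by blast
  qed
  then have "\<forall>R\<in>{0<..}. \<exists>c. c \<in> {R..q * R} \<and>
      integral {R..q * R} (\<lambda>t. ((q * R - t) / t) ^ m * g t) =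
      (q - 1) ^ m * (G c - G R) + 0 ^ m * (G (q * R) - G c)"
    by simp
  from bchoice[OF this] obtain c where c: "\<And>R. R > 0 \<Longrightarrow> c R \<in> {R..q * R}" and
    eq: "\<And>R. R > 0 \<Longrightarrow> integral {R..q * R} (\<lambda>t. ((q * R - t) / t) ^ m * g t) =
      (q - 1) ^ m * (G (c R) - G R) + 0 ^ m * (G (q * R) - G (c R))"
    by auto
  have c_top: "filterlim c at_top at_top"
    by (rule filterlim_at_top_mono[OF filterlim_ident])
      (use c in \<open>auto intro: eventually_mono[OF eventually_gt_at_top[of 0]]\<close>)
  have q_top: "filterlim (\<lambda>R. q * R) at_top at_top"
    using q by (intro filterlim_tendsto_pos_mult_at_top[OF tendsto_const]) (auto simp: filterlim_ident)
  have "((\<lambda>R. (q - 1) ^ m * (G (c R) - G R) + 0 ^ m * (G (q * R) - G (c R)))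
      \<longlongrightarrow> (q - 1) ^ m * (I - I) + 0 ^ m * (I - I)) at_top"
    by (intro tendsto_intros G filterlim_compose[OF G c_top] filterlim_compose[OF G q_top])
  moreover have "\<forall>\<^sub>F R in at_top. integral {R..q * R} (\<lambda>t. ((q * R - t) / t) ^ m * g t) =
      (q - 1) ^ m * (G (c R) - G R) + 0 ^ m * (G (q * R) - G (c R))"
    using eq by (auto intro: eventually_mono[OF eventually_gt_at_top[of 0]])
  ultimately show ?thesis
    by (simp add: tendsto_cong)
qed

section \<open>Taylor expansion of the finite difference\<close>

lemma Cn_on_has_vector_derivative:
  assumes "f \<in> Cn_on n S" "k < n" "x \<in> S"
  shows "(nth_deriv_within S k f has_vector_derivative nth_deriv_within S (Suc k) f x)
           (at x within S)"
  using assms by (auto simp: Cn_on_def differentiable_on_def vector_derivative_works)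

lemma Cn_on_Taylor_integral:
  assumes f: "f \<in> Cn_on n {0..}" and n: "n \<ge> 1" and x: "x \<ge> 0"
  shows "f x = (\<Sum>i<n. x ^ i / fact i * nth_deriv_within {0..} i f 0) +
           integral {0..x} (\<lambda>t. (x - t) ^ (n - 1) / fact (n - 1) * nth_deriv_within {0..} n f t)"
proof -
  have "(nth_deriv_within {0..} k f has_vector_derivative nth_deriv_within {0..} (Suc k) f t)
      (at t within {0..x})" if "k < n" "0 \<le> t" "t \<le> x" for k t
    using Cn_on_has_vector_derivative[OF f that(1), of t] that
    by (auto intro: has_vector_derivative_within_subset)
  then show ?thesis
    using Taylor_integral[of n "\<lambda>k. nth_deriv_within {0..} k f" f 0 x] n x by simp
qed

text \<open>
  The remainder of \<open>f (j * R)\<close> is split at \<open>R\<close>. Over \<open>{0..R}\<close> all integrands for \<open>j \<ge> 1\<close> are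
  present, and adding the one for \<open>j = 0\<close> would complete a vanishing \<open>n\<close>-th difference; hence
  they sum to minus the integral for \<open>j = 0\<close>, which is the truncated integral in question up to a
  constant. Over \<open>{R..j * R}\<close> the kernel is rewritten so as to exhibit the same integrand.
\<close>
lemma finite_difference_identity:
  fixes f :: "real \<Rightarrow> real" and R :: real
  assumes f: "f \<in> Cn_on n {0..}" and n: "n \<ge> 1" and R: "R > 0"
  defines "g \<equiv> \<lambda>t. t ^ (n - 1) * nth_deriv_within {0..} n f t"
  shows "(\<Sum>j\<le>n. (-1) ^ j * real (n choose j) * f (real j * R)) =
    (-1) ^ n * integral {0..R} g / fact (n - 1) +
    (\<Sum>j=1..n. (-1) ^ j * real (n choose j) *
       (integral {R..real j * R} (\<lambda>t. ((real j * R - t) / t) ^ (n - 1) * g t) / fact (n - 1)))"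
proof -
  define F where "F = nth_deriv_within {0..} n f"
  define c where "c j = (-1) ^ j * real (n choose j)" for j
  define T where "T j = (\<Sum>i<n. (real j * R) ^ i / fact i * nth_deriv_within {0..} i f 0)" for j
  define K where "K j t = (real j * R - t) ^ (n - 1) / fact (n - 1) * F t" for j t
  define A where "A j = integral {0..R} (K j)" for j
  define B where "B j = integral {R..real j * R} (\<lambda>t. ((real j * R - t) / t) ^ (n - 1) * g t)
     / fact (n - 1)" for j
  have F: "continuous_on {0..} F"
    using f by (simp add: Cn_on_def F_def)
  have K_int: "K j integrable_on {x..y}" if "x \<ge> 0" for j x y
    unfolding K_def
    by (intro integrable_continuous_real continuous_intros continuous_on_subset[OF F]) (use that in auto)
  have expand: "f (real j * R) = T j + A j + B j" if j: "j \<ge> 1" for j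
  proof -
    have le: "R \<le> real j * R"
      using j R by simp
    have "f (real j * R) = T j + integral {0..real j * R} (K j)"
      using Cn_on_Taylor_integral[OF f n, of "real j * R"] R
      by (simp add: T_def K_def[abs_def] F_def)
    also have "integral {0..real j * R} (K j) = A j + integral {R..real j * R} (K j)"
      unfolding A_def using R le K_int
      by (intro Henstock_Kurzweil_Integration.integral_combine[symmetric]) auto
    also have "integral {R..real j * R} (K j) =
        integral {R..real j * R} (\<lambda>t. ((real j * R - t) / t) ^ (n - 1) * g t / fact (n - 1))"
      using R by (intro integral_cong) (auto simp: K_def g_def F_def power_divide)
    also have "\<dots> = B j"
      by (simp add: B_def)
    finally show ?thesis by simp
  qed
  have T0: "f 0 = T 0"
    using Cn_on_Taylor_integral[OF f n, of 0] by (simp add: T_def)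
  have A0: "- A 0 = (-1) ^ n * integral {0..R} g / fact (n - 1)"
  proof -
    have "K 0 t = (-1) ^ (n - 1) / fact (n - 1) * g t" for t
      using power_minus[of t "n - 1"] by (simp add: K_def g_def F_def)
    then have "K 0 = (\<lambda>t. (-1) ^ (n - 1) / fact (n - 1) * g t)"
      by (rule ext)
    then have "A 0 = (-1) ^ (n - 1) / fact (n - 1) * integral {0..R} g"
      by (simp add: A_def)
    moreover have "(-1 :: real) ^ n = - ((-1) ^ (n - 1))"
      using n by (cases n) auto
    ultimately show ?thesis by simp
  qed
  have T_sum: "(\<Sum>j\<le>n. c j * T j) = 0"
  proof -
    have "(\<Sum>j\<le>n. c j * T j) = (\<Sum>i<n. nth_deriv_within {0..} i f 0 / fact i *
        (\<Sum>j\<le>n. (-1) ^ j * real (n choose j) * (0 + real j * R) ^ i))"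
      unfolding T_def c_def sum_distrib_left by (subst sum.swap) (simp add: mult_ac)
    also have "\<dots> = 0"
      by (intro sum.neutral ballI) (subst alternating_binomial_sum_power, auto)
    finally show ?thesis .
  qed
  have A_sum: "(\<Sum>j\<le>n. c j * A j) = 0"
  proof -
    have "(\<Sum>j\<le>n. c j * A j) = integral {0..R} (\<lambda>t. \<Sum>j\<le>n. c j * K j t)"
      unfolding A_def using K_int[of 0]
      by (subst integral_sum) (auto intro: integrable_on_mult_right)
    also have "(\<lambda>t. \<Sum>j\<le>n. c j * K j t) = (\<lambda>t. F t / fact (n - 1) *
        (\<Sum>j\<le>n. (-1) ^ j * real (n choose j) * (- t + real j * R) ^ (n - 1)))"
      unfolding sum_distrib_left by (simp add: K_def c_def mult_ac add.commute)
    also have "\<dots> = (\<lambda>t. 0)"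
      using n by (subst alternating_binomial_sum_power) auto
    finally show ?thesis by simp
  qed
  have split: "(\<Sum>j\<le>n. c j * u j) = u 0 + (\<Sum>j=1..n. c j * u j)" for u
    by (simp add: atLeast0AtMost [symmetric] sum.atLeast_Suc_atMost c_def)
  have "(\<Sum>j\<le>n. c j * f (real j * R)) = f 0 + (\<Sum>j=1..n. c j * (T j + A j + B j))"
    by (simp add: split expand)
  also have "\<dots> = (\<Sum>j\<le>n. c j * T j) + (\<Sum>j\<le>n. c j * A j) - A 0 + (\<Sum>j=1..n. c j * B j)"
    unfolding split by (simp add: T0 sum.distrib algebra_simps)
  also have "\<dots> = (-1) ^ n * integral {0..R} g / fact (n - 1) + (\<Sum>j=1..n. c j * B j)"
    using A0 by (simp add: T_sum A_sum)
  finally show ?thesis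
    by (simp add: c_def B_def)
qed

section \<open>The value of the integral\<close>

lemma tendsto_finite_difference_at_top:
  fixes f :: "real \<Rightarrow> real"
  assumes f: "(f \<longlongrightarrow> L) at_top" and n: "n \<ge> 1"
  shows "((\<lambda>R. \<Sum>j\<le>n. (-1) ^ j * real (n choose j) * f (real j * R)) \<longlongrightarrow> f 0 - L) at_top"
proof -
  have split: "(\<Sum>j\<le>n. (-1) ^ j * real (n choose j) * u j) =
      u 0 + (\<Sum>j=1..n. (-1) ^ j * real (n choose j) * u j)" for u
    by (simp add: atLeast0AtMost [symmetric] sum.atLeast_Suc_atMost)
  have lim: "((\<lambda>R. f (real j * R)) \<longlongrightarrow> L) at_top" if "j \<ge> 1" for j
    using that
    by (intro filterlim_compose[OF f] filterlim_tendsto_pos_mult_at_top[OF tendsto_const])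
      (auto simp: filterlim_ident)
  have "(\<Sum>j\<le>n. (-1) ^ j * real (n choose j) * L) = 0"
    using choose_alternating_sum[of n, where 'a = real] n by (simp flip: sum_distrib_right)
  then have "(\<Sum>j=1..n. (-1) ^ j * real (n choose j) * L) = - L"
    unfolding split by simp
  moreover have "((\<lambda>R. f 0 + (\<Sum>j=1..n. (-1) ^ j * real (n choose j) * f (real j * R)))
      \<longlongrightarrow> f 0 + (\<Sum>j=1..n. (-1) ^ j * real (n choose j) * L)) at_top"
    by (intro tendsto_intros lim) auto
  ultimately show ?thesis
    by (simp add: split)
qed

lemma improper_integral_value:
  fixes f :: "real \<Rightarrow> real"
  assumes f: "f \<in> Cn_on n {0..}" and n: "n \<ge> 1" and lim: "(f \<longlongrightarrow> L) at_top"
    and I: "has_improper_integral (\<lambda>t. t ^ (n - 1) * nth_deriv_within {0..} n f t) I"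
  shows "I = (-1) ^ (n - 1) * (L - f 0) * fact (n - 1)"
proof -
  define g where "g = (\<lambda>t. t ^ (n - 1) * nth_deriv_within {0..} n f t)"
  define E where "E j R = integral {R..real j * R} (\<lambda>t. ((real j * R - t) / t) ^ (n - 1) * g t)"
    for j R
  have g: "((\<lambda>R. integral {0..R} g) \<longlongrightarrow> I) at_top"
    using I by (simp add: has_improper_integral_def g_def)
  have E: "(E j \<longlongrightarrow> 0) at_top" if "j \<in> {1..n}" for j
    unfolding E_def[abs_def] using I that
    by (intro tendsto_weighted_tail_integral[where I = I]) (auto simp: g_def)
  have "((\<lambda>R. (-1) ^ n * integral {0..R} g / fact (n - 1) +
        (\<Sum>j=1..n. (-1) ^ j * real (n choose j) * (E j R / fact (n - 1))))
      \<longlongrightarrow> (-1) ^ n * I / fact (n - 1) +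
        (\<Sum>j=1..n. (-1) ^ j * real (n choose j) * (0 / fact (n - 1)))) at_top"
    by (intro tendsto_intros g E) auto
  moreover have "\<forall>\<^sub>F R in at_top. (\<Sum>j\<le>n. (-1) ^ j * real (n choose j) * f (real j * R)) =
      (-1) ^ n * integral {0..R} g / fact (n - 1) +
      (\<Sum>j=1..n. (-1) ^ j * real (n choose j) * (E j R / fact (n - 1)))"
    using finite_difference_identity[OF f n]
    by (auto simp: E_def g_def intro: eventually_mono[OF eventually_gt_at_top[of 0]])
  ultimately have "((\<lambda>R. \<Sum>j\<le>n. (-1) ^ j * real (n choose j) * f (real j * R))
      \<longlongrightarrow> (-1) ^ n * I / fact (n - 1)) at_top"
    by (simp add: tendsto_cong)
  then have "(-1) ^ n * I / fact (n - 1) = f 0 - L"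
    using tendsto_finite_difference_at_top[OF lim n] by (rule tendsto_unique[rotated]) simp
  then have "(-1) ^ n * I = (f 0 - L) * fact (n - 1)"
    by (simp add: field_simps)
  moreover obtain m where "n = Suc m"
    using n by (cases n) auto
  ultimately show ?thesis
    by (cases "even m") (simp_all add: algebra_simps)
qed

lemma Cn_on_improper_integral_deriv:
  fixes f :: "real \<Rightarrow> real"
  assumes f: "f \<in> Cn_on 1 {0..}" and lim: "(f \<longlongrightarrow> L) at_top"
  shows "has_improper_integral (nth_deriv_within {0..} 1 f) (L - f 0)"
proof -
  let ?F = "nth_deriv_within {0..} 1 f"
  have "continuous_on {0..} ?F"
    using f by (simp only: Cn_on_def mem_Collect_eq)
  then have int: "?F integrable_on {0..R}" for R
    by (intro integrable_continuous_real) (auto elim: continuous_on_subset)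
  have "integral {0..R} ?F = f R - f 0" if "R \<ge> 0" for R
    using Cn_on_Taylor_integral[OF f _ that] by simp
  then have "\<forall>\<^sub>F R in at_top. integral {0..R} ?F = f R - f 0"
    by (auto intro: eventually_mono[OF eventually_ge_at_top[of 0]])
  moreover have "((\<lambda>R. f R - f 0) \<longlongrightarrow> L - f 0) at_top"
    by (intro tendsto_intros lim)
  ultimately have "((\<lambda>R. integral {0..R} ?F) \<longlongrightarrow> L - f 0) at_top"
    by (subst tendsto_cong)
  with int show ?thesis
    unfolding has_improper_integral_def by blast
qed

theorem lemma2:
  fixes n :: nat and f :: "real \<Rightarrow> real" and f_inf :: real
  assumes "n \<ge> 1"
    and "f \<in> Cn_on n {0..}"
    and "(f \<longlongrightarrow> f_inf) at_top"
    and "n \<ge> 2 \<Longrightarrow>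
      improper_integral_converges (\<lambda>x. x ^ (n - 1) * nth_deriv_within {0..} n f x)"
  shows "has_improper_integral (\<lambda>x. x ^ (n - 1) * nth_deriv_within {0..} n f x)
           ((-1) ^ (n - 1) * (f_inf - f 0) * Gamma (real n))
         \<and> Gamma (real n) = fact (n - 1)"
proof -
  have Gamma: "Gamma (real n) = fact (n - 1)"
    using Gamma_fact[of "n - 1", where 'a = real] assms(1) by (simp add: of_nat_diff)
  obtain I where I: "has_improper_integral (\<lambda>x. x ^ (n - 1) * nth_deriv_within {0..} n f x) I"
  proof (cases "n = 1")
    case True
    with assms(2,3) Cn_on_improper_integral_deriv[of f f_inf] show ?thesis
      by (intro that[of "f_inf - f 0"]) (simp del: nth_deriv_within.simps)
  next
    case False
    with assms(1,4) show ?thesis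
      by (auto simp: improper_integral_converges_def intro: that)
  qed
  with improper_integral_value[OF assms(2,1,3) I] Gamma show ?thesis
    by simp
qed

end
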